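(* For each of the 18 triples $(\sigma,\tau_0,\tau_1)$ listed in the context, with corresponding Banach space $W$, the largest eigenvalue of the transfer operator $\mathcal{L}_{T_{\sigma,\tau_0,\tau_1}}:W\to W$ is $1$.
   Context: Let $\triangle=\{(x,y)\in\mathbb{R}^2: 0<y<x<1\}$ and let $\mathcal{C}(\triangle)$ be the space of real-valued continuous functions on $\triangle$. Eigenvalues are real numbers $\lambda$ with $\mathcal{L}\phi=\lambda\phi$ for some nonzero $\phi\in W$. Triangle partition maps. The elements of $S_3$ are written $e,12,13,23,123,132$ and identified with the $3\times 3$ permutation matrices acting on column vectors $v=(v_1,v_2,v_3)^T$ by: $e\,v=v$, $(12)v=(v_2,v_1,v_3)^T$, $(13)v=(v_3,v_2,v_1)^T$, $(23)v=(v_1,v_3,v_2)^T$, $(123)v=(v_2,v_3,v_1)^T$, $(132)v=(v_3,v_1,v_2)^T$. Put $$B=\begin{pmatrix}1&1&1\\0&1&1\\0&0&1\end{pmatrix},\quad A_0=\begin{pmatrix}0&0&1\\1&0&0\\0&1&1\end{pmatrix},\quad A_1=\begin{pmatrix}1&0&1\\0&1&0\\0&0&1\end{pmatrix}.$$ For $(\sigma,\tau_0,\tau_1)\in S_3^3$ let $F_0=\sigma A_0\tau_0$, $F_1=\sigma A_1\tau_1$ (matrix products). For $k\ge 0$ and $(x,y)\in\triangle$ write $(d_k,p_k,q_k)^T=BF_1^kF_0B^{-1}(1,x,y)^T$ and $S_k(x,y)=(p_k/d_k,\,q_k/d_k)$; here $d_k>0$. $S_k$ maps $\triangle$ bijectively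 onto an open subtriangle $\triangle_k\subset\triangle$, the $\triangle_k$ are pairwise disjoint, and the triangle partition map $T_{\sigma,\tau_0,\tau_1}$ is defined on $\bigcup_k\triangle_k$ by $T_{\sigma,\tau_0,\tau_1}=S_k^{-1}$ on $\triangle_k$. Its transfer operator is $$\mathcal{L}_{T_{\sigma,\tau_0,\tau_1}}f(x,y)=\sum_{(a,b):T_{\sigma,\tau_0,\tau_1}(a,b)=(x,y)}\frac{f(a,b)}{|\mathrm{Jac}(T_{\sigma,\tau_0,\tau_1})(a,b)|}=\sum_{k=0}^\infty \frac{1}{d_k(x,y)^3}\,f(S_k(x,y)).$$ The corresponding Banach space is $W=\{f\in\mathcal{C}(\triangle):\exists\,C\in\mathbb{R},\ |g f|<C\text{ on }\triangle\}$ with norm $\|f\|=\sup_\triangle|gf|$, where $g=g(x,y)$ depends on the triple as follows (18 triples): $g=x$ for $(e,e,e)$, $(23,23,23)$; $g=x(1-y)$ for $(e,23,e)$, $(e,132,e)$, $(13,23,13)$, $(13,132,13)$; $g=1-x+y$ for $(12,12,12)$, $(132,123,123)$; $g=(1-y)(1-x+y)$ for $(12,13,12)$, $(12,123,12)$, $(123,13,132)$, $(123,123,132)$; $g=1-y$ for $(13,13,13)$; $g=x(1-x+y)$ for $(23,e,23)$, $(23,12,23)$, $(132,e,123)$, $(132,12,123)$; $g=(1-y)(1+x-y)$ for $(123,132,132)$. *)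

theory Defs
  imports "HOL-Analysis.Analysis"
begin

definition triangle :: "(real^2) set" where
  "triangle = {v. 0 < v$2 \<and> v$2 < v$1 \<and> v$1 < 1}"

datatype S3 = Pe | P12 | P13 | P23 | P123 | P132

primrec perm_mat :: "S3 \<Rightarrow> real^3^3" where
  "perm_mat Pe = matrix (\<lambda>v. v)"
| "perm_mat P12 = matrix (\<lambda>v. vector [v$2, v$1, v$3])"
| "perm_mat P13 = matrix (\<lambda>v. vector [v$3, v$2, v$1])"
| "perm_mat P23 = matrix (\<lambda>v. vector [v$1, v$3, v$2])"
| "perm_mat P123 = matrix (\<lambda>v. vector [v$2, v$3, v$1])"
| "perm_mat P132 = matrix (\<lambda>v. vector [v$3, v$1, v$2])"

text \<open>The matrix of a permutation acts as prescribed: each map inside \<open>matrix\<close> above is linear.\<close>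

lemma perm_mat_mult_vector:
  fixes v :: "real^3"
  shows "perm_mat Pe *v v = v"
    and "perm_mat P12 *v v = vector [v$2, v$1, v$3]"
    and "perm_mat P13 *v v = vector [v$3, v$2, v$1]"
    and "perm_mat P23 *v v = vector [v$1, v$3, v$2]"
    and "perm_mat P123 *v v = vector [v$2, v$3, v$1]"
    and "perm_mat P132 *v v = vector [v$3, v$1, v$2]"
  by (simp_all add: vec_eq_iff forall_3 matrix_def matrix_vector_mult_def sum_3 axis_def)

text \<open>Matrices are given by their list of rows.\<close>

definition mat_B :: "real^3^3" where
  "mat_B = vector [vector [1, 1, 1], vector [0, 1, 1], vector [0, 0, 1]]"

definition mat_A0 :: "real^3^3" where
  "mat_A0 = vector [vector [0, 0, 1], vector [1, 0, 0], vector [0, 1, 1]]"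

definition mat_A1 :: "real^3^3" where
  "mat_A1 = vector [vector [1, 0, 1], vector [0, 1, 0], vector [0, 0, 1]]"

definition mat_F0 :: "S3 \<Rightarrow> S3 \<Rightarrow> real^3^3" where
  "mat_F0 \<sigma> \<tau>0 = perm_mat \<sigma> ** mat_A0 ** perm_mat \<tau>0"

definition mat_F1 :: "S3 \<Rightarrow> S3 \<Rightarrow> real^3^3" where
  "mat_F1 \<sigma> \<tau>1 = perm_mat \<sigma> ** mat_A1 ** perm_mat \<tau>1"

text \<open>The iteration of \<open>**\<close> is the matrix power; \<open>^\<close> on \<open>real^3^3\<close> would be componentwise.\<close>

definition dpq :: "S3 \<Rightarrow> S3 \<Rightarrow> S3 \<Rightarrow> nat \<Rightarrow> real^2 \<Rightarrow> real^3" where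
  "dpq \<sigma> \<tau>0 \<tau>1 k v =
     (mat_B ** (((**) (mat_F1 \<sigma> \<tau>1)) ^^ k) (mat 1) ** mat_F0 \<sigma> \<tau>0 ** matrix_inv mat_B)
       *v vector [1, v$1, v$2]"

definition branch :: "S3 \<Rightarrow> S3 \<Rightarrow> S3 \<Rightarrow> nat \<Rightarrow> real^2 \<Rightarrow> real^2" where
  "branch \<sigma> \<tau>0 \<tau>1 k v =
     (let w = dpq \<sigma> \<tau>0 \<tau>1 k v in vector [w$2 / w$1, w$3 / w$1])"

definition subtriangle :: "S3 \<Rightarrow> S3 \<Rightarrow> S3 \<Rightarrow> nat \<Rightarrow> (real^2) set" where
  "subtriangle \<sigma> \<tau>0 \<tau>1 k = branch \<sigma> \<tau>0 \<tau>1 k ` triangle"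

text \<open>The map is meaningful on the union of the (pairwise disjoint) subtriangles only.\<close>

definition triangle_map :: "S3 \<Rightarrow> S3 \<Rightarrow> S3 \<Rightarrow> real^2 \<Rightarrow> real^2" where
  "triangle_map \<sigma> \<tau>0 \<tau>1 p =
     inv_into triangle (branch \<sigma> \<tau>0 \<tau>1 (THE k. p \<in> subtriangle \<sigma> \<tau>0 \<tau>1 k)) p"

definition preimages :: "S3 \<Rightarrow> S3 \<Rightarrow> S3 \<Rightarrow> real^2 \<Rightarrow> (real^2) set" where
  "preimages \<sigma> \<tau>0 \<tau>1 v =
     {p \<in> (\<Union>k. subtriangle \<sigma> \<tau>0 \<tau>1 k). triangle_map \<sigma> \<tau>0 \<tau>1 p = v}"

definition transfer_summand ::
    "S3 \<Rightarrow> S3 \<Rightarrow> S3 \<Rightarrow> (real^2 \<Rightarrow> real) \<Rightarrow> real^2 \<Rightarrow> real" where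
  "transfer_summand \<sigma> \<tau>0 \<tau>1 f p = f p / \<bar>det (jacobian (triangle_map \<sigma> \<tau>0 \<tau>1) (at p))\<bar>"

definition transfer ::
    "S3 \<Rightarrow> S3 \<Rightarrow> S3 \<Rightarrow> (real^2 \<Rightarrow> real) \<Rightarrow> real^2 \<Rightarrow> real" where
  "transfer \<sigma> \<tau>0 \<tau>1 f v =
     (\<Sum>\<^sub>\<infinity>p\<in>preimages \<sigma> \<tau>0 \<tau>1 v. transfer_summand \<sigma> \<tau>0 \<tau>1 f p)"

text \<open>Elements of the function space are considered on \<open>triangle\<close> only: two functions that agree
  there represent the same element, and their values elsewhere are irrelevant.\<close>

definition weighted_space :: "(real \<Rightarrow> real \<Rightarrow> real) \<Rightarrow> (real^2 \<Rightarrow> real) set" where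
  "weighted_space g =
     {f. continuous_on triangle f \<and> (\<exists>C. \<forall>v\<in>triangle. \<bar>g (v$1) (v$2) * f v\<bar> < C)}"

definition transfer_well_defined ::
    "S3 \<Rightarrow> S3 \<Rightarrow> S3 \<Rightarrow> (real \<Rightarrow> real \<Rightarrow> real) \<Rightarrow> bool" where
  "transfer_well_defined \<sigma> \<tau>0 \<tau>1 g \<longleftrightarrow>
     (\<forall>f\<in>weighted_space g.
        (\<forall>v\<in>triangle. transfer_summand \<sigma> \<tau>0 \<tau>1 f summable_on preimages \<sigma> \<tau>0 \<tau>1 v) \<and>
        transfer \<sigma> \<tau>0 \<tau>1 f \<in> weighted_space g)"

definition transfer_eigenvalues ::
    "S3 \<Rightarrow> S3 \<Rightarrow> S3 \<Rightarrow> (real \<Rightarrow> real \<Rightarrow> real) \<Rightarrow> real set" where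
  "transfer_eigenvalues \<sigma> \<tau>0 \<tau>1 g =
     {l. \<exists>\<phi>\<in>weighted_space g. (\<exists>v\<in>triangle. \<phi> v \<noteq> 0) \<and>
           (\<forall>v\<in>triangle. transfer \<sigma> \<tau>0 \<tau>1 \<phi> v = l * \<phi> v)}"

text \<open>The eighteen triples \<open>(\<sigma>, \<tau>0, \<tau>1)\<close>, each with the weight \<open>g\<close> of its function space.\<close>

definition weighted_triples :: "(S3 \<times> S3 \<times> S3 \<times> (real \<Rightarrow> real \<Rightarrow> real)) set" where
  "weighted_triples =
    {(Pe, Pe, Pe, \<lambda>x y. x),
     (P23, P23, P23, \<lambda>x y. x),
     (Pe, P23, Pe, \<lambda>x y. x * (1 - y)),
     (Pe, P132, Pe, \<lambda>x y. x * (1 - y)),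
     (P13, P23, P13, \<lambda>x y. x * (1 - y)),
     (P13, P132, P13, \<lambda>x y. x * (1 - y)),
     (P12, P12, P12, \<lambda>x y. 1 - x + y),
     (P132, P123, P123, \<lambda>x y. 1 - x + y),
     (P12, P13, P12, \<lambda>x y. (1 - y) * (1 - x + y)),
     (P12, P123, P12, \<lambda>x y. (1 - y) * (1 - x + y)),
     (P123, P13, P132, \<lambda>x y. (1 - y) * (1 - x + y)),
     (P123, P123, P132, \<lambda>x y. (1 - y) * (1 - x + y)),
     (P13, P13, P13, \<lambda>x y. 1 - y),
     (P23, Pe, P23, \<lambda>x y. x * (1 - x + y)),
     (P23, P12, P23, \<lambda>x y. x * (1 - x + y)),
     (P132, Pe, P123, \<lambda>x y. x * (1 - x + y)),
     (P132, P12, P123, \<lambda>x y. x * (1 - x + y)),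
     (P123, P132, P132, \<lambda>x y. (1 - y) * (1 + x - y))}"

end

theory Submission
  imports Defs
begin

text \<open>
  In the barycentric coordinates \<open>u = (1 - x, x - y, y)\<close> each branch \<open>S\<^sub>k\<close> is the projective map of
  the matrix \<open>N\<^sub>k = F\<^sub>1\<^sup>k F\<^sub>0\<close>, which has determinant of modulus one and sends positive vectors to positive
  vectors. A projective map of a matrix \<open>M\<close> in homogeneous coordinates has Jacobian determinant
  \<open>det M / d\<^sup>3\<close>, where \<open>d\<close> is the denominator, so the sum over preimages that defines the transfer
  operator is the series of \<open>f (S\<^sub>k v) / d\<^sub>k v ^ 3\<close> (\<open>transfer_series\<close>). The branches have
  disjoint images, since \<open>\<sigma>\<^sup>-\<^sup>1\<close> takes the image of \<open>F\<^sub>0\<close> into the vectors whose first coordinate is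
  smaller than the third, and the image of \<open>F\<^sub>1\<close> into those where it is larger.

  The eighteen triples form three orbits under relabelling the vertices of the triangle. With
  \<open>t = \<tau>1 u\<close> the matrix \<open>N\<^sub>k\<close> becomes \<open>A\<^sub>1\<^sup>k A\<^sub>0 \<kappa>\<close>, where \<open>\<kappa>\<close> is the identity, \<open>23\<close> or \<open>132\<close>. In
  each of the three cases there are two positive affine functions \<open>\<alpha>\<close>, \<open>\<beta>\<close> of \<open>t\<close> such that
  \<open>h = 1 / (\<alpha> \<beta>)\<close> satisfies
  \<open>h (S\<^sub>k v) / d\<^sub>k v ^ 3 = 1 / ((\<alpha> v + k \<beta> v) (\<alpha> v + (k + 1) \<beta> v))\<close>.
  This series telescopes to \<open>h v\<close>: the density \<open>h\<close> is invariant, an eigenfunction for the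
  eigenvalue 1.

  The weight \<open>g\<close> lies between constant multiples of \<open>\<alpha> \<beta>\<close>, so the function space consists of the continuous
  functions bounded by a multiple of \<open>h\<close>. The operator is positive and fixes \<open>h\<close>, hence
  \<open>\<bar>f\<bar> \<le> C h\<close> implies \<open>\<bar>L f\<bar> \<le> C h\<close>: the operator is a contraction for the norm \<open>sup \<bar>f\<bar> / h\<close>, and no
  eigenvalue exceeds 1 in modulus. All this is \<open>transfer_spectrum\<close>; the orbits are treated in
  \<open>weighted_triples_orbits\<close> and \<open>branch_normal_form\<close>.
\<close>

section \<open>Projective maps of the plane\<close>

definition homog :: "real^2 \<Rightarrow> real^3" where
  "homog v = vector [1, v$1, v$2]"

definition projmap :: "real^3^3 \<Rightarrow> real^2 \<Rightarrow> real^2" where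
  "projmap M v = (let w = M *v homog v in vector [w$2 / w$1, w$3 / w$1])"

lemma homog_nth [simp]: "homog v $ 1 = 1" "homog v $ 2 = v$1" "homog v $ 3 = v$2"
  by (simp_all add: homog_def)

lemma matrix_homog_nth: "(M *v homog v) $ i = M$i$1 + M$i$2 * v$1 + M$i$3 * v$2"
  by (simp add: matrix_vector_mult_def sum_3)

lemma homog_projmap:
  assumes "(M *v homog v)$1 \<noteq> 0"
  shows "homog (projmap M v) = (1 / (M *v homog v)$1) *\<^sub>R (M *v homog v)"
  using assms by (simp add: vec_eq_iff forall_3 projmap_def Let_def)

lemma projmap_eqI:
  assumes "M *v homog v = c *\<^sub>R homog p" "c \<noteq> 0"
  shows "projmap M v = p"
  using assms by (simp add: vec_eq_iff forall_2 projmap_def Let_def)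

text \<open>A vector and its multiples represent the same point, so it is enough that \<open>R\<close> undoes \<open>M\<close>
  on \<open>homog v\<close> itself.\<close>

lemma projmap_left_inverse:
  assumes "R ** M = mat 1" "(M *v homog v)$1 \<noteq> 0"
  shows "projmap R (projmap M v) = v"
proof (rule projmap_eqI)
  have "R *v (M *v homog v) = homog v"
    using assms(1) by (simp add: matrix_vector_mul_assoc)
  then show "R *v homog (projmap M v) = (1 / (M *v homog v)$1) *\<^sub>R homog v"
    using assms(2) by (simp add: homog_projmap matrix_vector_mult_scaleR)
qed (use assms(2) in simp)

lemma continuous_on_matrix_homog: "continuous_on S (\<lambda>v. (M *v homog v) $ i)"
  unfolding matrix_homog_nth by (intro continuous_intros)

lemma continuous_on_projmap:
  assumes "\<And>v. v \<in> S \<Longrightarrow> (M *v homog v)$1 \<noteq> 0"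
  shows "continuous_on S (projmap M)"
proof -
  have "continuous_on S (\<lambda>v. projmap M v $ i)" for i
  proof -
    have "\<forall>i. continuous_on S (\<lambda>v. projmap M v $ i)"
      unfolding forall_2 projmap_def Let_def
      by (auto intro!: continuous_on_divide continuous_on_matrix_homog assms)
    then show ?thesis by blast
  qed
  then show ?thesis
    using continuous_on_vec_lambda[of S "\<lambda>i v. projmap M v $ i"] by simp
qed

lemma has_derivative_projmap:
  fixes M :: "real^3^3" and v :: "real^2"
  defines "w \<equiv> M *v homog v"
  assumes "w$1 \<noteq> 0"
  shows "(projmap M has_derivative (\<lambda>h. vector
     [(w$1 * (M$2$2 * h$1 + M$2$3 * h$2) - w$2 * (M$1$2 * h$1 + M$1$3 * h$2)) / (w$1)^2,
      (w$1 * (M$3$2 * h$1 + M$3$3 * h$2) - w$3 * (M$1$2 * h$1 + M$1$3 * h$2)) / (w$1)^2])) (at v)"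
proof -
  have lin: "((\<lambda>v. (M *v homog v)$i) has_derivative (\<lambda>h. M$i$2 * h$1 + M$i$3 * h$2)) (at v)" for i
    unfolding matrix_homog_nth
    by (auto intro!: derivative_eq_intros bounded_linear_imp_has_derivative bounded_linear_vec_nth)
  have quot: "((\<lambda>v. (M *v homog v)$i / (M *v homog v)$1) has_derivative (\<lambda>h.
      (w$1 * (M$i$2 * h$1 + M$i$3 * h$2) - w$i * (M$1$2 * h$1 + M$1$3 * h$2)) / (w$1)^2)) (at v)" for i
    by (rule has_derivative_eq_rhs, rule has_derivative_divide[OF lin lin])
       (use assms in \<open>auto simp: w_def field_simps power2_eq_square\<close>)
  have "\<forall>i::2. ((\<lambda>v. projmap M v $ i) has_derivative (\<lambda>h. vector
     [(w$1 * (M$2$2 * h$1 + M$2$3 * h$2) - w$2 * (M$1$2 * h$1 + M$1$3 * h$2)) / (w$1)^2,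
      (w$1 * (M$3$2 * h$1 + M$3$3 * h$2) - w$3 * (M$1$2 * h$1 + M$1$3 * h$2)) / (w$1)^2] $ i)) (at v)"
    unfolding forall_2 projmap_def Let_def using quot[of 2] quot[of 3] by simp
  then show ?thesis
    by (subst has_derivative_componentwise_within) (auto simp: Basis_vec_def inner_axis)
qed

text \<open>The quotient rule gives a \<open>2 \<times> 2\<close> determinant. By Cramer's rule it is, up to a power of the denominator,
  the determinant of \<open>M\<close> with its first column replaced by \<open>w\<close>; as \<open>w\<close> is the first column plus a
  combination of the other two, that determinant is \<open>det M\<close>.\<close>

lemma det_jacobian_projmap:
  fixes M :: "real^3^3" and v :: "real^2"
  assumes "(M *v homog v)$1 \<noteq> 0"
  shows "det (jacobian (projmap M) (at v)) = det M / ((M *v homog v)$1)^3"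
proof -
  define w where "w = M *v homog v"
  have w: "w$i = M$i$1 + M$i$2 * v$1 + M$i$3 * v$2" for i
    by (simp add: w_def matrix_homog_nth)
  have nz: "w$1 \<noteq> 0" using assms by (simp add: w_def)
  have "det (jacobian (projmap M) (at v))
    = ((w$1 * M$2$2 - w$2 * M$1$2) * (w$1 * M$3$3 - w$3 * M$1$3)
       - (w$1 * M$2$3 - w$2 * M$1$3) * (w$1 * M$3$2 - w$3 * M$1$2)) / (w$1)^4"
    unfolding jacobian_def
      frechet_derivative_at[OF has_derivative_projmap[OF assms], symmetric] w_def[symmetric]
    by (simp add: det_2 matrix_def axis_def flip: power_add diff_divide_distrib)
  also have "\<dots> = w$1 * det M / (w$1)^4"
    unfolding w det_3 by (rule arg_cong[where f = "\<lambda>z. z / _"]) algebra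
  also have "\<dots> = det M / (w$1)^3"
    using nz by (simp add: field_simps power_numeral_reduce)
  finally show ?thesis by (simp add: w_def)
qed


section \<open>The matrices in barycentric coordinates\<close>

lemma matrix_inv_mat_B:
  "matrix_inv mat_B = vector [vector [1, -1, 0], vector [0, 1, -1], vector [0, 0, 1]]"
  (is "_ = ?U")
proof -
  have 1: "mat_B ** ?U = mat 1" "?U ** mat_B = mat 1"
    by (simp_all add: mat_B_def vec_eq_iff forall_3 matrix_matrix_mult_def sum_3 mat_def)
  then have "invertible mat_B" unfolding invertible_def by blast
  then have "mat_B ** matrix_inv mat_B = mat 1"
    unfolding matrix_inv_def invertible_def by (rule someI2_ex) blast
  then have "(?U ** mat_B) ** matrix_inv mat_B = ?U"
    by (simp flip: matrix_mul_assoc)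
  then show ?thesis using 1 by simp
qed

definition pos :: "real^3 \<Rightarrow> bool" where
  "pos u \<longleftrightarrow> (\<forall>i. 0 < u$i)"

text \<open>The weights of \<open>v\<close> with respect to the vertices \<open>(0,0)\<close>, \<open>(1,0)\<close>, \<open>(1,1)\<close>, on which the matrices
  \<open>F\<^sub>0\<close> and \<open>F\<^sub>1\<close> act.\<close>

definition bary :: "real^2 \<Rightarrow> real^3" where
  "bary v = vector [1 - v$1, v$1 - v$2, v$2]"

lemma bary_eq: "bary v = matrix_inv mat_B *v homog v"
  by (simp add: bary_def matrix_inv_mat_B vec_eq_iff forall_3 matrix_vector_mult_def sum_3)

lemma mat_B_inverse: "mat_B ** matrix_inv mat_B = mat 1" "matrix_inv mat_B ** mat_B = mat 1"
  unfolding matrix_inv_mat_B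
  by (simp_all add: mat_B_def vec_eq_iff forall_3 matrix_matrix_mult_def sum_3 mat_def)

lemma triangle_iff_pos: "v \<in> triangle \<longleftrightarrow> pos (bary v)"
  by (auto simp: triangle_def pos_def bary_def forall_3)

lemma det_mat_B: "det mat_B = 1" "det (matrix_inv mat_B) = 1"
  unfolding matrix_inv_mat_B by (simp_all add: mat_B_def det_3)

lemma mat_A0_mult: "mat_A0 *v u = vector [u$3, u$1, u$2 + u$3]"
  by (simp add: mat_A0_def vec_eq_iff forall_3 matrix_vector_mult_def sum_3)

lemma mat_A1_mult: "mat_A1 *v u = vector [u$1 + u$3, u$2, u$3]"
  by (simp add: mat_A1_def vec_eq_iff forall_3 matrix_vector_mult_def sum_3)

lemma mat_B_mult_1: "(mat_B *v u) $ 1 = u$1 + u$2 + u$3"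
  by (simp add: mat_B_def matrix_vector_mult_def sum_3)

lemma abs_det_perm_mat: "\<bar>det (perm_mat s)\<bar> = 1"
  by (cases s) (simp_all add: det_3 matrix_def axis_def)

lemma perm_mat_left_inverse: "\<exists>s'. perm_mat s' ** perm_mat s = mat 1"
proof -
  have "perm_mat (case s of P123 \<Rightarrow> P132 | P132 \<Rightarrow> P123 | _ \<Rightarrow> s) ** perm_mat s = mat 1"
    unfolding matrix_eq
    by (cases s)
       (simp_all add: perm_mat_mult_vector vec_eq_iff forall_3 del: perm_mat.simps
         flip: matrix_vector_mul_assoc)
  then show ?thesis by blast
qed

lemma pos_perm_mat: "pos u \<Longrightarrow> pos (perm_mat s *v u)"
  by (cases s) (simp_all add: pos_def forall_3 perm_mat_mult_vector del: perm_mat.simps)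

lemma pos_mat_A: "pos u \<Longrightarrow> pos (mat_A0 *v u)" "pos u \<Longrightarrow> pos (mat_A1 *v u)"
  by (simp_all add: pos_def forall_3 mat_A0_mult mat_A1_mult add_pos_pos)

lemma pos_mat_F:
  assumes "pos u"
  shows "pos (mat_F0 \<sigma> \<tau>0 *v u)" "pos (mat_F1 \<sigma> \<tau>1 *v u)"
  using assms
  by (simp_all add: mat_F0_def mat_F1_def pos_perm_mat pos_mat_A flip: matrix_vector_mul_assoc)

lemma det_mat_A: "det mat_A0 = 1" "det mat_A1 = 1"
  by (simp_all add: mat_A0_def mat_A1_def det_3)

lemma abs_det_mat_F: "\<bar>det (mat_F0 \<sigma> \<tau>0)\<bar> = 1" "\<bar>det (mat_F1 \<sigma> \<tau>1)\<bar> = 1"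
  by (simp_all add: mat_F0_def mat_F1_def det_mul abs_mult abs_det_perm_mat det_mat_A)

definition iter_mat :: "S3 \<Rightarrow> S3 \<Rightarrow> S3 \<Rightarrow> nat \<Rightarrow> real^3^3" where
  "iter_mat \<sigma> \<tau>0 \<tau>1 k = (((**) (mat_F1 \<sigma> \<tau>1)) ^^ k) (mat 1) ** mat_F0 \<sigma> \<tau>0"

lemma iter_mat_0: "iter_mat \<sigma> \<tau>0 \<tau>1 0 = mat_F0 \<sigma> \<tau>0"
  by (simp add: iter_mat_def)

lemma iter_mat_Suc: "iter_mat \<sigma> \<tau>0 \<tau>1 (Suc k) = mat_F1 \<sigma> \<tau>1 ** iter_mat \<sigma> \<tau>0 \<tau>1 k"
  by (simp add: iter_mat_def matrix_mul_assoc)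

lemma pos_iter_mat: "pos u \<Longrightarrow> pos (iter_mat \<sigma> \<tau>0 \<tau>1 k *v u)"
  by (induction k)
     (simp_all add: iter_mat_0 iter_mat_Suc pos_mat_F flip: matrix_vector_mul_assoc)

lemma abs_det_iter_mat: "\<bar>det (iter_mat \<sigma> \<tau>0 \<tau>1 k)\<bar> = 1"
  by (induction k) (simp_all add: iter_mat_0 iter_mat_Suc abs_det_mat_F det_mul abs_mult)

text \<open>After \<open>\<sigma>\<^sup>-\<^sup>1\<close>, a vector in the image of \<open>F\<^sub>0 = \<sigma> A\<^sub>0 \<tau>0\<close> has the form \<open>(a\<^sub>3, a\<^sub>1, a\<^sub>2 + a\<^sub>3)\<close>, whereas one in
  the image of \<open>F\<^sub>1 = \<sigma> A\<^sub>1 \<tau>1\<close> has the form \<open>(b\<^sub>1 + b\<^sub>3, b\<^sub>2, b\<^sub>3)\<close>; comparing the first with the third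
  coordinate tells them apart, up to scaling. So \<open>j = k\<close> follows by cancelling factors \<open>F\<^sub>1\<close>.\<close>

lemma proportional_iter_mat_imp_eq:
  assumes "pos u" "pos u'"
    and "iter_mat \<sigma> \<tau>0 \<tau>1 j *v u = c *\<^sub>R (iter_mat \<sigma> \<tau>0 \<tau>1 k *v u')" "0 < c"
  shows "j = k"
proof -
  obtain s where "perm_mat s ** perm_mat \<sigma> = mat 1"
    using perm_mat_left_inverse by blast
  then have s: "perm_mat s *v (perm_mat \<sigma> *v x) = x" for x
    by (simp add: matrix_vector_mul_assoc)
  have separated: False
    if "pos u" "pos u'" "0 < c"
      and eq: "mat_F0 \<sigma> \<tau>0 *v u = c *\<^sub>R (iter_mat \<sigma> \<tau>0 \<tau>1 (Suc k) *v u')" for u u' c k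
  proof -
    define a where "a = perm_mat \<tau>0 *v u"
    define b where "b = perm_mat \<tau>1 *v (iter_mat \<sigma> \<tau>0 \<tau>1 k *v u')"
    have ab: "pos a" "pos b"
      using that by (simp_all add: a_def b_def pos_perm_mat pos_iter_mat)
    have "perm_mat \<sigma> *v (mat_A0 *v a) = c *\<^sub>R (perm_mat \<sigma> *v (mat_A1 *v b))"
      using eq
      by (simp add: a_def b_def mat_F0_def mat_F1_def iter_mat_Suc flip: matrix_vector_mul_assoc)
    then have "perm_mat s *v (perm_mat \<sigma> *v (mat_A0 *v a))
      = perm_mat s *v (c *\<^sub>R (perm_mat \<sigma> *v (mat_A1 *v b)))" by simp
    then have "mat_A0 *v a = c *\<^sub>R (mat_A1 *v b)"
      by (simp add: matrix_vector_mult_scaleR s)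
    then have "a$3 = c * (b$1 + b$3)" "a$2 + a$3 = c * b$3"
      by (simp_all add: mat_A0_mult mat_A1_mult vec_eq_iff forall_3)
    moreover have "0 < a$2" "0 < c * b$1"
      using ab \<open>0 < c\<close> by (simp_all add: pos_def)
    ultimately show False by (simp add: algebra_simps)
  qed
  show ?thesis
    using assms
  proof (induction j arbitrary: k c)
    case 0
    then show ?case
      using separated by (cases k) (auto simp: iter_mat_0)
  next
    case (Suc j)
    show ?case
    proof (cases k)
      case 0
      have "mat_F0 \<sigma> \<tau>0 *v u' = (1/c) *\<^sub>R (iter_mat \<sigma> \<tau>0 \<tau>1 (Suc j) *v u)"
        using Suc.prems 0 by (simp add: iter_mat_0)
      then show ?thesis
        using separated[of u' u "1/c" j] Suc.prems by simp
    next
      case (Suc k')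
      have "invertible (mat_F1 \<sigma> \<tau>1)"
        using abs_det_mat_F(2)[of \<sigma> \<tau>1] by (auto simp: invertible_det_nz)
      then obtain R where "R ** mat_F1 \<sigma> \<tau>1 = mat 1"
        unfolding invertible_def by blast
      then have R: "R *v (mat_F1 \<sigma> \<tau>1 *v x) = x" for x
        by (simp add: matrix_vector_mul_assoc)
      have "mat_F1 \<sigma> \<tau>1 *v (iter_mat \<sigma> \<tau>0 \<tau>1 j *v u)
        = mat_F1 \<sigma> \<tau>1 *v (c *\<^sub>R (iter_mat \<sigma> \<tau>0 \<tau>1 k' *v u'))"
        using Suc.prems Suc
        by (simp add: iter_mat_Suc matrix_vector_mult_scaleR flip: matrix_vector_mul_assoc)
      then have "R *v (mat_F1 \<sigma> \<tau>1 *v (iter_mat \<sigma> \<tau>0 \<tau>1 j *v u))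
        = R *v (mat_F1 \<sigma> \<tau>1 *v (c *\<^sub>R (iter_mat \<sigma> \<tau>0 \<tau>1 k' *v u')))"
        by simp
      then have "iter_mat \<sigma> \<tau>0 \<tau>1 j *v u = c *\<^sub>R (iter_mat \<sigma> \<tau>0 \<tau>1 k' *v u')"
        by (simp add: R)
      then show ?thesis
        using Suc.IH Suc.prems Suc by blast
    qed
  qed
qed

section \<open>Branches, the triangle map and the transfer series\<close>

definition branch_mat :: "S3 \<Rightarrow> S3 \<Rightarrow> S3 \<Rightarrow> nat \<Rightarrow> real^3^3" where
  "branch_mat \<sigma> \<tau>0 \<tau>1 k = mat_B ** iter_mat \<sigma> \<tau>0 \<tau>1 k ** matrix_inv mat_B"

lemma dpq_eq: "dpq \<sigma> \<tau>0 \<tau>1 k v = branch_mat \<sigma> \<tau>0 \<tau>1 k *v homog v"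
  by (simp add: dpq_def branch_mat_def iter_mat_def homog_def matrix_mul_assoc)

lemma branch_eq: "branch \<sigma> \<tau>0 \<tau>1 k = projmap (branch_mat \<sigma> \<tau>0 \<tau>1 k)"
  by (simp add: fun_eq_iff branch_def projmap_def dpq_eq)

lemma dpq_eq_iter: "dpq \<sigma> \<tau>0 \<tau>1 k v = mat_B *v (iter_mat \<sigma> \<tau>0 \<tau>1 k *v bary v)"
  by (simp add: dpq_eq branch_mat_def bary_eq flip: matrix_vector_mul_assoc)

lemma dpq_1_pos:
  assumes "v \<in> triangle"
  shows "0 < dpq \<sigma> \<tau>0 \<tau>1 k v $ 1"
  using pos_iter_mat[of "bary v" \<sigma> \<tau>0 \<tau>1 k] assms
  by (simp add: dpq_eq_iter mat_B_mult_1 triangle_iff_pos pos_def add_pos_pos)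

lemma continuous_on_branch: "continuous_on triangle (branch \<sigma> \<tau>0 \<tau>1 k)"
  unfolding branch_eq using dpq_1_pos
  by (intro continuous_on_projmap) (simp add: dpq_eq[symmetric] less_imp_neq[THEN not_sym])

lemma bary_branch:
  assumes "v \<in> triangle"
  shows "bary (branch \<sigma> \<tau>0 \<tau>1 k v) =
    (1 / dpq \<sigma> \<tau>0 \<tau>1 k v $ 1) *\<^sub>R (iter_mat \<sigma> \<tau>0 \<tau>1 k *v bary v)"
proof -
  have "homog (branch \<sigma> \<tau>0 \<tau>1 k v) = (1 / dpq \<sigma> \<tau>0 \<tau>1 k v $ 1) *\<^sub>R dpq \<sigma> \<tau>0 \<tau>1 k v"
    using dpq_1_pos[OF assms, of \<sigma> \<tau>0 \<tau>1 k] by (simp add: branch_eq dpq_eq homog_projmap)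
  then have "bary (branch \<sigma> \<tau>0 \<tau>1 k v) =
    matrix_inv mat_B *v ((1 / dpq \<sigma> \<tau>0 \<tau>1 k v $ 1) *\<^sub>R dpq \<sigma> \<tau>0 \<tau>1 k v)"
    by (simp add: bary_eq)
  also have "\<dots> = (1 / dpq \<sigma> \<tau>0 \<tau>1 k v $ 1) *\<^sub>R (matrix_inv mat_B *v dpq \<sigma> \<tau>0 \<tau>1 k v)"
    by (rule matrix_vector_mult_scaleR)
  also have "matrix_inv mat_B *v dpq \<sigma> \<tau>0 \<tau>1 k v = iter_mat \<sigma> \<tau>0 \<tau>1 k *v bary v"
    by (metis dpq_eq_iter mat_B_inverse(2) matrix_vector_mul_assoc matrix_vector_mul_lid)
  finally show ?thesis .
qed

lemma branch_in_triangle: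
  assumes "v \<in> triangle"
  shows "branch \<sigma> \<tau>0 \<tau>1 k v \<in> triangle"
  using pos_iter_mat[of "bary v" \<sigma> \<tau>0 \<tau>1 k] dpq_1_pos[OF assms, of \<sigma> \<tau>0 \<tau>1 k] assms
  unfolding triangle_iff_pos bary_branch[OF assms] by (simp add: pos_def)

lemma subtriangle_disjoint:
  assumes "p \<in> subtriangle \<sigma> \<tau>0 \<tau>1 j" "p \<in> subtriangle \<sigma> \<tau>0 \<tau>1 k"
  shows "j = k"
proof -
  obtain v w where v: "v \<in> triangle" "p = branch \<sigma> \<tau>0 \<tau>1 j v"
    and w: "w \<in> triangle" "p = branch \<sigma> \<tau>0 \<tau>1 k w"
    using assms unfolding subtriangle_def by blast
  define dv dw where "dv = dpq \<sigma> \<tau>0 \<tau>1 j v $ 1" and "dw = dpq \<sigma> \<tau>0 \<tau>1 k w $ 1"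
  have d: "0 < dv" "0 < dw"
    using v w by (simp_all add: dv_def dw_def dpq_1_pos)
  have "(1 / dv) *\<^sub>R (iter_mat \<sigma> \<tau>0 \<tau>1 j *v bary v) = (1 / dw) *\<^sub>R (iter_mat \<sigma> \<tau>0 \<tau>1 k *v bary w)"
    using bary_branch[OF v(1), of \<sigma> \<tau>0 \<tau>1 j] bary_branch[OF w(1), of \<sigma> \<tau>0 \<tau>1 k] v(2) w(2)
    by (simp add: dv_def dw_def)
  then have "dv *\<^sub>R (1 / dv) *\<^sub>R (iter_mat \<sigma> \<tau>0 \<tau>1 j *v bary v)
    = dv *\<^sub>R (1 / dw) *\<^sub>R (iter_mat \<sigma> \<tau>0 \<tau>1 k *v bary w)" by simp
  then have "iter_mat \<sigma> \<tau>0 \<tau>1 j *v bary v = (dv / dw) *\<^sub>R (iter_mat \<sigma> \<tau>0 \<tau>1 k *v bary w)"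
    using d by simp
  with v(1) w(1) d show ?thesis
    using proportional_iter_mat_imp_eq[of "bary v" "bary w" \<sigma> \<tau>0 \<tau>1 j "dv / dw" k]
    by (simp add: triangle_iff_pos)
qed

lemma branch_mat_inverse:
  obtains R where "R ** branch_mat \<sigma> \<tau>0 \<tau>1 k = mat 1" "branch_mat \<sigma> \<tau>0 \<tau>1 k ** R = mat 1"
    "\<bar>det R\<bar> = 1"
proof -
  have d: "\<bar>det (branch_mat \<sigma> \<tau>0 \<tau>1 k)\<bar> = 1"
    by (simp add: branch_mat_def det_mul abs_mult abs_det_iter_mat det_mat_B)
  then have "invertible (branch_mat \<sigma> \<tau>0 \<tau>1 k)"
    by (auto simp: invertible_det_nz)
  then obtain R where R: "R ** branch_mat \<sigma> \<tau>0 \<tau>1 k = mat 1" "branch_mat \<sigma> \<tau>0 \<tau>1 k ** R = mat 1"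
    unfolding invertible_def by blast
  have "\<bar>det R\<bar> * \<bar>det (branch_mat \<sigma> \<tau>0 \<tau>1 k)\<bar> = 1"
    by (metis R(1) abs_mult abs_one det_I det_mul)
  with d R that show ?thesis by simp
qed

lemma inj_on_branch: "inj_on (branch \<sigma> \<tau>0 \<tau>1 k) triangle"
proof -
  obtain R where "R ** branch_mat \<sigma> \<tau>0 \<tau>1 k = mat 1"
    using branch_mat_inverse by blast
  then show ?thesis
    using dpq_1_pos
    by (intro inj_on_inverseI[where g = "projmap R"])
       (simp add: branch_eq projmap_left_inverse less_imp_neq[THEN not_sym] flip: dpq_eq)
qed

lemma triangle_map_branch:
  assumes "v \<in> triangle"
  shows "triangle_map \<sigma> \<tau>0 \<tau>1 (branch \<sigma> \<tau>0 \<tau>1 k v) = v"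
proof -
  have k: "branch \<sigma> \<tau>0 \<tau>1 k v \<in> subtriangle \<sigma> \<tau>0 \<tau>1 k"
    using assms by (simp add: subtriangle_def)
  then have "(THE k'. branch \<sigma> \<tau>0 \<tau>1 k v \<in> subtriangle \<sigma> \<tau>0 \<tau>1 k') = k"
    by (rule the_equality) (rule subtriangle_disjoint[OF _ k])
  then show ?thesis
    by (simp add: triangle_map_def inv_into_f_f inj_on_branch assms)
qed

text \<open>Differentiating the triangle map at a point needs a formula valid on a whole neighbourhood. The
  subtriangle is cut out by strict inequalities: those of the triangle, pulled back by the inverse
  matrix.\<close>

lemma open_subtriangle: "open (subtriangle \<sigma> \<tau>0 \<tau>1 k)"
proof -
  obtain R where R: "R ** branch_mat \<sigma> \<tau>0 \<tau>1 k = mat 1" "branch_mat \<sigma> \<tau>0 \<tau>1 k ** R = mat 1"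
    using branch_mat_inverse by blast
  define w where "w p = R *v homog p" for p
  have "subtriangle \<sigma> \<tau>0 \<tau>1 k = {p. 0 < w p $ 3 \<and> w p $ 3 < w p $ 2 \<and> w p $ 2 < w p $ 1}"
    (is "_ = ?U")
  proof (intro equalityI subsetI)
    fix p assume "p \<in> subtriangle \<sigma> \<tau>0 \<tau>1 k"
    then obtain v where v: "v \<in> triangle" "p = branch \<sigma> \<tau>0 \<tau>1 k v"
      unfolding subtriangle_def by blast
    define d where "d = dpq \<sigma> \<tau>0 \<tau>1 k v $ 1"
    have d: "0 < d" using v by (simp add: d_def dpq_1_pos)
    have "homog p = (1 / d) *\<^sub>R (branch_mat \<sigma> \<tau>0 \<tau>1 k *v homog v)"
      using d v(2) by (simp add: branch_eq homog_projmap d_def dpq_eq)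
    then have "w p = (1 / d) *\<^sub>R homog v"
      by (simp add: w_def matrix_vector_mult_scaleR matrix_vector_mul_assoc R)
    then show "p \<in> ?U"
      using v(1) d by (simp add: triangle_def divide_strict_right_mono)
  next
    fix p assume p: "p \<in> ?U"
    then have pos: "0 < w p $ 1" by simp
    have v: "projmap R p \<in> triangle"
      using p by (simp add: triangle_def projmap_def Let_def flip: w_def) (simp add: divide_strict_right_mono)
    have "projmap (branch_mat \<sigma> \<tau>0 \<tau>1 k) (projmap R p) = p"
      using pos R(2) by (intro projmap_left_inverse) (simp_all flip: w_def)
    with v show "p \<in> subtriangle \<sigma> \<tau>0 \<tau>1 k"
      unfolding subtriangle_def branch_eq by (metis imageI)
  qed
  moreover have "open ?U"
    unfolding w_def
    by (intro open_Collect_conj open_Collect_less continuous_on_const continuous_on_matrix_homog)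
  ultimately show ?thesis by simp
qed

text \<open>On the subtriangle the triangle map is the projective map of the inverse matrix \<open>R\<close>, and the
  denominator of that map at \<open>S\<^sub>k v\<close> is the reciprocal of the denominator \<open>d\<^sub>k v\<close> of the branch.\<close>

lemma abs_det_jacobian_triangle_map:
  assumes "v \<in> triangle"
  shows "\<bar>det (jacobian (triangle_map \<sigma> \<tau>0 \<tau>1) (at (branch \<sigma> \<tau>0 \<tau>1 k v)))\<bar>
    = (dpq \<sigma> \<tau>0 \<tau>1 k v $ 1) ^ 3"
proof -
  obtain R where R: "R ** branch_mat \<sigma> \<tau>0 \<tau>1 k = mat 1" "\<bar>det R\<bar> = 1"
    using branch_mat_inverse by blast
  let ?p = "branch \<sigma> \<tau>0 \<tau>1 k v"
  define d where "d = dpq \<sigma> \<tau>0 \<tau>1 k v $ 1"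
  have d: "0 < d" using assms by (simp add: d_def dpq_1_pos)
  have "homog ?p = (1 / d) *\<^sub>R (branch_mat \<sigma> \<tau>0 \<tau>1 k *v homog v)"
    using d by (simp add: branch_eq homog_projmap d_def dpq_eq)
  then have w: "(R *v homog ?p) $ 1 = 1 / d"
    by (simp add: matrix_vector_mult_scaleR matrix_vector_mul_assoc R)
  have eq: "projmap R q = triangle_map \<sigma> \<tau>0 \<tau>1 q" if q: "q \<in> subtriangle \<sigma> \<tau>0 \<tau>1 k" for q
  proof -
    obtain u where u: "u \<in> triangle" "q = branch \<sigma> \<tau>0 \<tau>1 k u"
      using q unfolding subtriangle_def by blast
    have "projmap R q = u"
      unfolding u(2) branch_eq using dpq_1_pos[OF u(1), of \<sigma> \<tau>0 \<tau>1 k]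
      by (intro projmap_left_inverse R) (simp add: dpq_eq)
    with u show ?thesis by (simp add: triangle_map_branch)
  qed
  have p: "?p \<in> subtriangle \<sigma> \<tau>0 \<tau>1 k"
    using assms by (simp add: subtriangle_def)
  have nz: "(R *v homog ?p) $ 1 \<noteq> 0"
    using w d by simp
  have "(triangle_map \<sigma> \<tau>0 \<tau>1 has_derivative frechet_derivative (projmap R) (at ?p)) (at ?p)"
    by (rule has_derivative_transform_within_open[OF _ open_subtriangle p eq])
       (use has_derivative_projmap[OF nz] frechet_derivative_works differentiable_def in blast)
  then have "jacobian (triangle_map \<sigma> \<tau>0 \<tau>1) (at ?p) = jacobian (projmap R) (at ?p)"
    unfolding jacobian_def by (simp flip: frechet_derivative_at)
  then show ?thesis
    using R(2) d by (simp add: det_jacobian_projmap[OF nz] w abs_mult power_divide flip: d_def)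
qed

lemma preimages_eq:
  assumes "v \<in> triangle"
  shows "preimages \<sigma> \<tau>0 \<tau>1 v = range (\<lambda>k. branch \<sigma> \<tau>0 \<tau>1 k v)"
proof -
  have "p \<in> preimages \<sigma> \<tau>0 \<tau>1 v \<longleftrightarrow> (\<exists>k. p = branch \<sigma> \<tau>0 \<tau>1 k v)" for p
    unfolding preimages_def subtriangle_def using assms triangle_map_branch by fastforce
  then show ?thesis by blast
qed

lemma inj_branch_index:
  assumes "v \<in> triangle"
  shows "inj (\<lambda>k. branch \<sigma> \<tau>0 \<tau>1 k v)"
  by (rule injI, rule subtriangle_disjoint[of "branch \<sigma> \<tau>0 \<tau>1 _ v"])
     (use assms in \<open>auto simp: subtriangle_def\<close>)

lemma transfer_series:
  assumes "v \<in> triangle"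
  shows "(transfer_summand \<sigma> \<tau>0 \<tau>1 f has_sum S) (preimages \<sigma> \<tau>0 \<tau>1 v) \<longleftrightarrow>
    ((\<lambda>k. f (branch \<sigma> \<tau>0 \<tau>1 k v) / (dpq \<sigma> \<tau>0 \<tau>1 k v $ 1) ^ 3) has_sum S) UNIV"
  by (simp add: preimages_eq[OF assms] has_sum_reindex[OF inj_branch_index[OF assms]] o_def
      transfer_summand_def abs_det_jacobian_triangle_map[OF assms])

section \<open>Spectrum from a telescoping density\<close>

text \<open>The summand is \<open>(1 / b) (1 / (a + k b) - 1 / (a + (k + 1) b))\<close>.\<close>

lemma telescoping_sums:
  fixes a b :: real
  assumes "0 < a" "0 < b"
  shows "(\<lambda>k. 1 / ((a + real k * b) * (a + real (Suc k) * b))) sums (1 / (a * b))"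
proof -
  have "filterlim (\<lambda>k. a + real k * b) at_top sequentially"
    using assms(2)
    by (intro filterlim_tendsto_add_at_top[OF tendsto_const]
        filterlim_at_top_mult_tendsto_pos[OF tendsto_const _ filterlim_real_sequentially])
  then have "(\<lambda>k. 1 / b * inverse (a + real k * b)) \<longlonglongrightarrow> 1 / b * 0"
    by (intro tendsto_mult tendsto_const tendsto_inverse_0_at_top)
  then have "(\<lambda>k. 1 / b * inverse (a + real k * b) - 1 / b * inverse (a + real (Suc k) * b))
      sums (1 / b * inverse (a + real 0 * b) - 1 / b * 0)"
    by (rule telescope_sums')
  moreover have "1 / b * inverse (a + real k * b) - 1 / b * inverse (a + real (Suc k) * b)
      = 1 / ((a + real k * b) * (a + real (Suc k) * b))" for k
  proof -
    have "0 < a + real k * b" "0 < a + real (Suc k) * b"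
      using assms by (simp_all add: add_pos_nonneg)
    then show ?thesis
      using assms by (simp add: divide_simps del: of_nat_Suc) (simp add: algebra_simps)
  qed
  ultimately show ?thesis
    by (simp add: inverse_eq_divide mult.commute)
qed

text \<open>The space depends on the weight only up to constant factors, so \<open>g\<close> may be replaced by any
  comparable \<open>\<rho>\<close>, in particular by the reciprocal of the invariant density.\<close>

lemma weighted_space_iff:
  fixes \<rho> :: "real^2 \<Rightarrow> real"
  assumes "\<And>v. v \<in> triangle \<Longrightarrow> 0 < \<rho> v"
    and "0 < m"
    and "\<And>v. v \<in> triangle \<Longrightarrow> m * \<rho> v \<le> g (v$1) (v$2)"
    and "\<And>v. v \<in> triangle \<Longrightarrow> g (v$1) (v$2) \<le> K * \<rho> v"
  shows "f \<in> weighted_space g \<longleftrightarrow>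
    continuous_on triangle f \<and> (\<exists>C. \<forall>v\<in>triangle. \<bar>f v\<bar> \<le> C * (1 / \<rho> v))"
proof -
  have "\<bar>f v\<bar> \<le> C / m * (1 / \<rho> v)"
    if v: "v \<in> triangle" and "\<bar>g (v$1) (v$2) * f v\<bar> < C" for v C
  proof -
    have "m * \<rho> v * \<bar>f v\<bar> \<le> g (v$1) (v$2) * \<bar>f v\<bar>"
      by (rule mult_right_mono[OF assms(3)[OF v]]) simp
    also have "\<dots> \<le> \<bar>g (v$1) (v$2) * f v\<bar>"
      by (simp add: abs_mult mult_right_mono)
    also have "\<dots> \<le> C" using that by simp
    finally show ?thesis
      using assms(1)[OF v] assms(2) by (simp add: field_simps)
  qed
  moreover have "\<bar>g (v$1) (v$2) * f v\<bar> < K * C + 1"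
    if v: "v \<in> triangle" and "\<bar>f v\<bar> \<le> C * (1 / \<rho> v)" for v C
  proof -
    have "0 < m * \<rho> v" using assms(1)[OF v] assms(2) by simp
    also note assms(3)[OF v]
    finally have g: "0 < g (v$1) (v$2)" .
    have "\<bar>g (v$1) (v$2) * f v\<bar> = g (v$1) (v$2) * \<bar>f v\<bar>"
      using g by (simp add: abs_mult)
    also have "\<dots> \<le> (K * \<rho> v) * (C * (1 / \<rho> v))"
      using that g assms(4)[OF v] by (intro mult_mono) auto
    also have "\<dots> = K * C"
      using assms(1)[OF v] by simp
    finally show ?thesis by simp
  qed
  ultimately have "(\<exists>C. \<forall>v\<in>triangle. \<bar>g (v$1) (v$2) * f v\<bar> < C) \<longleftrightarrow>
      (\<exists>C. \<forall>v\<in>triangle. \<bar>f v\<bar> \<le> C * (1 / \<rho> v))"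
    by meson
  then show ?thesis
    by (simp only: weighted_space_def mem_Collect_eq)
qed

lemma open_triangle: "open triangle"
  unfolding triangle_def
  by (intro open_Collect_conj open_Collect_less continuous_intros)

text \<open>Everything about the spectrum follows from the identity \<open>branch\<close>, which says that
  \<open>h = 1 / (\<alpha> \<beta>)\<close> turns the transfer series into a telescoping one with sum \<open>h\<close>. The series for any
  function bounded by \<open>C h\<close> is then dominated by \<open>C\<close> times this telescoping series.\<close>

lemma transfer_spectrum:
  fixes \<alpha> \<beta> :: "real^2 \<Rightarrow> real"
  assumes pos: "\<And>v. v \<in> triangle \<Longrightarrow> 0 < \<alpha> v" "\<And>v. v \<in> triangle \<Longrightarrow> 0 < \<beta> v"
    and cont: "continuous_on triangle \<alpha>" "continuous_on triangle \<beta>"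
    and "0 < m"
    and weight: "\<And>v. v \<in> triangle \<Longrightarrow> m * (\<alpha> v * \<beta> v) \<le> g (v$1) (v$2)"
      "\<And>v. v \<in> triangle \<Longrightarrow> g (v$1) (v$2) \<le> K * (\<alpha> v * \<beta> v)"
    and branch: "\<And>k v. v \<in> triangle \<Longrightarrow>
      \<alpha> (branch \<sigma> \<tau>0 \<tau>1 k v) * \<beta> (branch \<sigma> \<tau>0 \<tau>1 k v) * (dpq \<sigma> \<tau>0 \<tau>1 k v $ 1) ^ 3
        = (\<alpha> v + real k * \<beta> v) * (\<alpha> v + real (Suc k) * \<beta> v)"
  shows "transfer_well_defined \<sigma> \<tau>0 \<tau>1 g"
    and "1 \<in> transfer_eigenvalues \<sigma> \<tau>0 \<tau>1 g"
    and "l \<in> transfer_eigenvalues \<sigma> \<tau>0 \<tau>1 g \<Longrightarrow> l \<le> 1"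
proof -
  let ?S = "branch \<sigma> \<tau>0 \<tau>1" and ?d = "\<lambda>k v. dpq \<sigma> \<tau>0 \<tau>1 k v $ 1"
  define h where "h v = 1 / (\<alpha> v * \<beta> v)" for v
  define a where "a k v = 1 / ((\<alpha> v + real k * \<beta> v) * (\<alpha> v + real (Suc k) * \<beta> v))" for k v
  have h_pos: "0 < h v" if "v \<in> triangle" for v
    using pos[OF that] by (simp add: h_def)
  have a_pos: "0 < a k v" if "v \<in> triangle" for k v
    unfolding a_def
    by (intro divide_pos_pos mult_pos_pos add_pos_nonneg mult_nonneg_nonneg) (simp_all add: pos that less_imp_le)
  have a_sums: "(\<lambda>k. a k v) sums h v" if "v \<in> triangle" for v
    unfolding a_def h_def using pos[OF that] by (rule telescoping_sums)
  have h_branch: "h (?S k v) / ?d k v ^ 3 = a k v" if "v \<in> triangle" for k v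
    unfolding h_def a_def branch[OF that, symmetric] by simp
  have W_iff: "f \<in> weighted_space g \<longleftrightarrow>
      continuous_on triangle f \<and> (\<exists>C. \<forall>v\<in>triangle. \<bar>f v\<bar> \<le> C * h v)" for f
    unfolding h_def using pos \<open>0 < m\<close> weight by (intro weighted_space_iff) auto
  have term_bound: "\<bar>f (?S k v) / ?d k v ^ 3\<bar> \<le> C * a k v"
    if v: "v \<in> triangle" and f: "\<forall>v\<in>triangle. \<bar>f v\<bar> \<le> C * h v" for f C k v
  proof -
    have "\<bar>f (?S k v) / ?d k v ^ 3\<bar> = \<bar>f (?S k v)\<bar> / ?d k v ^ 3"
      using dpq_1_pos[OF v, of \<sigma> \<tau>0 \<tau>1 k] by simp
    also have "\<dots> \<le> C * h (?S k v) / ?d k v ^ 3"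
      using f branch_in_triangle[OF v] dpq_1_pos[OF v, of \<sigma> \<tau>0 \<tau>1 k]
      by (intro divide_right_mono) auto
    also have "\<dots> = C * a k v"
      by (simp add: h_branch[OF v, symmetric])
    finally show ?thesis .
  qed
  have transfer_has_sum:
    "(transfer_summand \<sigma> \<tau>0 \<tau>1 f has_sum (\<Sum>k. f (?S k v) / ?d k v ^ 3)) (preimages \<sigma> \<tau>0 \<tau>1 v)"
    if v: "v \<in> triangle" and f: "\<forall>v\<in>triangle. \<bar>f v\<bar> \<le> C * h v" for f C v
  proof -
    have "summable (\<lambda>k. C * a k v)"
      by (rule summable_mult[OF sums_summable[OF a_sums[OF v]]])
    then have summable: "summable (\<lambda>k. norm (f (?S k v) / ?d k v ^ 3))"
      by (rule summable_comparison_test'[where N = 0]) (use term_bound[OF v f] in simp)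
    show ?thesis
      unfolding transfer_series[OF v]
      by (rule norm_summable_imp_has_sum[OF summable summable_sums[OF summable_norm_cancel[OF summable]]])
  qed
  have transfer_eq: "transfer \<sigma> \<tau>0 \<tau>1 f v = (\<Sum>k. f (?S k v) / ?d k v ^ 3)"
    if "v \<in> triangle" "\<forall>v\<in>triangle. \<bar>f v\<bar> \<le> C * h v" for f C v
    unfolding transfer_def by (rule infsumI[OF transfer_has_sum[OF that]])
  have transfer_bound: "\<bar>transfer \<sigma> \<tau>0 \<tau>1 f v\<bar> \<le> C * h v"
    if v: "v \<in> triangle" and f: "\<forall>v\<in>triangle. \<bar>f v\<bar> \<le> C * h v" for f C v
  proof -
    have *: "(\<lambda>k. C * a k v) sums (C * h v)"
      by (rule sums_mult[OF a_sums[OF v]])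
    have "norm (\<Sum>k. f (?S k v) / ?d k v ^ 3) \<le> (\<Sum>k. C * a k v)"
      by (rule norm_suminf_le[OF _ sums_summable[OF *]]) (use term_bound[OF v f] in simp)
    then show ?thesis
      using sums_unique[OF *] by (simp add: transfer_eq[OF v f])
  qed
  have transfer_cont: "continuous_on triangle (transfer \<sigma> \<tau>0 \<tau>1 f)"
    if f_cont: "continuous_on triangle f" and f: "\<forall>v\<in>triangle. \<bar>f v\<bar> \<le> C * h v" for f C
  proof -
    \<comment> \<open>The domination is uniform only where \<open>\<alpha>\<close> and \<open>\<beta>\<close> stay away from \<open>0\<close>, so the continuity of the sum
      is established on these open pieces, which exhaust the triangle.\<close>
    define U where "U e = {v \<in> triangle. \<alpha> v \<in> {e<..} \<and> \<beta> v \<in> {e<..}}" for e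
    have U_open: "open (U e)" for e
    proof -
      have "U e = (triangle \<inter> \<alpha> -` {e<..}) \<inter> (triangle \<inter> \<beta> -` {e<..})"
        by (auto simp: U_def)
      then show ?thesis
        by (simp add: open_Int continuous_open_preimage cont open_triangle)
    qed
    have triangle_eq: "triangle = (\<Union>e\<in>{0<..}. U e)"
    proof (intro equalityI subsetI)
      fix v assume v: "v \<in> triangle"
      then have "v \<in> U (min (\<alpha> v) (\<beta> v) / 2)" "0 < min (\<alpha> v) (\<beta> v) / 2"
        using pos[OF v] by (auto simp: U_def min_def)
      then show "v \<in> (\<Union>e\<in>{0<..}. U e)" by blast
    qed (auto simp: U_def)
    have "continuous_on (U e) (transfer \<sigma> \<tau>0 \<tau>1 f)" if e: "0 < e" for e
    proof -
      have bound: "norm (f (?S k v) / ?d k v ^ 3)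
          \<le> \<bar>C\<bar> / e^2 * (1 / ((1 + real k * 1) * (1 + real (Suc k) * 1)))"
        if v: "v \<in> U e" for k v
      proof -
        have v': "v \<in> triangle" "e \<le> \<alpha> v" "e \<le> \<beta> v"
          using v by (auto simp: U_def)
        have le: "e * (1 + real j * 1) \<le> \<alpha> v + real j * \<beta> v" for j
          using mult_left_mono[OF v'(3), of "real j"] v'(2) by (simp add: algebra_simps)
        have "(e * (1 + real k * 1)) * (e * (1 + real (Suc k) * 1))
            \<le> (\<alpha> v + real k * \<beta> v) * (\<alpha> v + real (Suc k) * \<beta> v)"
          by (intro mult_mono le) (use e pos[OF v'(1)] in \<open>auto intro!: add_nonneg_nonneg\<close>)
        then have "a k v \<le> 1 / ((e * (1 + real k * 1)) * (e * (1 + real (Suc k) * 1)))"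
          unfolding a_def using e by (intro divide_left_mono mult_pos_pos)
            (auto intro!: add_pos_nonneg mult_nonneg_nonneg simp: pos v' less_imp_le)
        then have "\<bar>C\<bar> * a k v \<le> \<bar>C\<bar> * (1 / ((e * (1 + real k * 1)) * (e * (1 + real (Suc k) * 1))))"
          by (rule mult_left_mono) simp
        moreover have "C * a k v \<le> \<bar>C\<bar> * a k v"
          using a_pos[OF v'(1), of k] by (intro mult_right_mono) auto
        ultimately show ?thesis
          using term_bound[OF v'(1) f, of k] by (simp add: power2_eq_square mult_ac)
      qed
      have "summable (\<lambda>k. \<bar>C\<bar> / e^2 * (1 / ((1 + real k * 1) * (1 + real (Suc k) * 1))))"
        by (intro summable_mult sums_summable[OF telescoping_sums]) auto
      note unif = Weierstrass_m_test[of "U e" "\<lambda>k v. f (?S k v) / ?d k v ^ 3", OF bound this]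
      have term_cont: "continuous_on (U e) (\<lambda>v. f (?S k v) / ?d k v ^ 3)" for k
      proof -
        have "continuous_on triangle (\<lambda>v. f (?S k v))"
          using branch_in_triangle
          by (intro continuous_on_compose2[OF f_cont continuous_on_branch]) auto
        moreover have "continuous_on triangle (\<lambda>v. ?d k v)"
          unfolding dpq_eq by (rule continuous_on_matrix_homog)
        ultimately have "continuous_on triangle (\<lambda>v. f (?S k v) / ?d k v ^ 3)"
          using dpq_1_pos
          by (intro continuous_on_divide continuous_on_power) (auto simp: less_imp_neq[THEN not_sym])
        then show ?thesis
          by (rule continuous_on_subset) (auto simp: U_def)
      qed
      have "continuous_on (U e) (\<lambda>v. \<Sum>k. f (?S k v) / ?d k v ^ 3)"
        by (rule uniform_limit_theorem[OF _ unif])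
           (auto intro!: always_eventually continuous_on_sum term_cont)
      then show ?thesis
        by (rule continuous_on_cong[THEN iffD1, rotated -1])
           (auto simp: U_def transfer_eq[OF _ f])
    qed
    then show ?thesis
      unfolding triangle_eq by (intro continuous_on_open_UN U_open) auto
  qed
  show "transfer_well_defined \<sigma> \<tau>0 \<tau>1 g"
    unfolding transfer_well_defined_def
  proof (intro ballI conjI)
    fix f assume "f \<in> weighted_space g"
    then obtain C where f_cont: "continuous_on triangle f" and f: "\<forall>v\<in>triangle. \<bar>f v\<bar> \<le> C * h v"
      unfolding W_iff by blast
    show "transfer_summand \<sigma> \<tau>0 \<tau>1 f summable_on preimages \<sigma> \<tau>0 \<tau>1 v" if "v \<in> triangle" for v
      by (rule has_sum_imp_summable[OF transfer_has_sum[OF that f]])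
    show "transfer \<sigma> \<tau>0 \<tau>1 f \<in> weighted_space g"
      unfolding W_iff using transfer_cont[OF f_cont f] transfer_bound[OF _ f] by blast
  qed
  show "1 \<in> transfer_eigenvalues \<sigma> \<tau>0 \<tau>1 g"
  proof -
    have h_le: "\<forall>v\<in>triangle. \<bar>h v\<bar> \<le> 1 * h v"
      using h_pos by (simp add: less_imp_le)
    have eig: "\<forall>v\<in>triangle. transfer \<sigma> \<tau>0 \<tau>1 h v = 1 * h v"
    proof
      fix v assume v: "v \<in> triangle"
      show "transfer \<sigma> \<tau>0 \<tau>1 h v = 1 * h v"
        using sums_unique[OF a_sums[OF v]] by (simp add: transfer_eq[OF v h_le] h_branch[OF v])
    qed
    have h_W: "h \<in> weighted_space g"
    proof -
      have "continuous_on triangle h"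
        unfolding h_def[abs_def]
        by (intro continuous_on_divide continuous_on_mult continuous_on_const cont)
           (metis less_irrefl mult_pos_pos pos)
      then show ?thesis
        unfolding W_iff using h_le by blast
    qed
    have "(vector [1/2, 1/4] :: real^2) \<in> triangle"
      by (simp add: triangle_def)
    then have "\<exists>v\<in>triangle. h v \<noteq> 0"
      using h_pos by (metis less_irrefl)
    then show ?thesis
      unfolding transfer_eigenvalues_def mem_Collect_eq
      by (intro bexI[OF _ h_W] conjI eig)
  qed
  show "l \<le> 1" if l: "l \<in> transfer_eigenvalues \<sigma> \<tau>0 \<tau>1 g"
  proof -
    obtain \<phi> v0 where \<phi>_W: "\<phi> \<in> weighted_space g" and v0: "v0 \<in> triangle" "\<phi> v0 \<noteq> 0"
      and eig: "\<forall>v\<in>triangle. transfer \<sigma> \<tau>0 \<tau>1 \<phi> v = l * \<phi> v"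
      using l unfolding transfer_eigenvalues_def by blast
    obtain C where \<phi>: "\<forall>v\<in>triangle. \<bar>\<phi> v\<bar> \<le> C * h v"
      using \<phi>_W unfolding W_iff by blast
    \<comment> \<open>\<open>N\<close> is the norm of \<open>\<phi>\<close> relative to \<open>h\<close>, for which the operator is a contraction.\<close>
    define N where "N = (SUP v\<in>triangle. \<bar>\<phi> v\<bar> / h v)"
    have bdd: "bdd_above ((\<lambda>v. \<bar>\<phi> v\<bar> / h v) ` triangle)"
      using \<phi> h_pos by (intro bdd_aboveI2[where M = C]) (simp add: divide_le_eq)
    have le_N: "\<forall>v\<in>triangle. \<bar>\<phi> v\<bar> \<le> N * h v"
    proof
      fix v assume v: "v \<in> triangle"
      have "\<bar>\<phi> v\<bar> / h v \<le> N"
        unfolding N_def by (rule cSUP_upper[OF v bdd])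
      then show "\<bar>\<phi> v\<bar> \<le> N * h v"
        using h_pos[OF v] by (simp add: divide_le_eq)
    qed
    have "0 < \<bar>\<phi> v0\<bar> / h v0" using v0 h_pos by simp
    also have "\<dots> \<le> N" unfolding N_def by (rule cSUP_upper[OF v0(1) bdd])
    finally have "0 < N" .
    have l_le: "\<bar>l\<bar> * (\<bar>\<phi> v\<bar> / h v) \<le> N" if v: "v \<in> triangle" for v
      using transfer_bound[OF v le_N] eig v h_pos[OF v] by (simp add: abs_mult divide_le_eq)
    have "\<bar>l\<bar> \<le> 1"
    proof (cases "l = 0")
      case False
      have "N \<le> N / \<bar>l\<bar>"
        unfolding N_def
      proof (rule cSUP_least)
        show "\<bar>\<phi> v\<bar> / h v \<le> (SUP v\<in>triangle. \<bar>\<phi> v\<bar> / h v) / \<bar>l\<bar>" if "v \<in> triangle" for v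
          using l_le[OF that] False by (simp add: le_divide_eq mult.commute flip: N_def)
      qed (use v0 in blast)
      then show ?thesis
        using False \<open>0 < N\<close> by (simp add: le_divide_eq)
    qed simp
    then show ?thesis by simp
  qed
qed

section \<open>The three orbits of triples\<close>

text \<open>In every triple \<open>\<tau>1\<close> inverts \<open>\<sigma>\<close> and \<open>\<tau>0 = \<kappa> \<tau>1\<close> for one of three permutations \<open>\<kappa>\<close>, so a triple is
  obtained from \<open>(e, \<kappa>, e)\<close> by relabelling the vertices. In the coordinates \<open>t\<close> the weight depends on
  \<open>\<kappa>\<close> alone, except in the triple \<open>(123, 132, 132)\<close>, where it carries the additional factor
  \<open>1 + x - y\<close> with values between 1 and 2.\<close>

lemma weighted_triples_orbits:
  assumes "(\<sigma>, \<tau>0, \<tau>1, g) \<in> weighted_triples"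
  defines "t \<equiv> \<lambda>v. perm_mat \<tau>1 *v bary v"
  shows "perm_mat \<tau>1 *v (perm_mat \<sigma> *v x) = x"
    and "(\<forall>x. perm_mat \<tau>0 *v x = perm_mat Pe *v (perm_mat \<tau>1 *v x)) \<and>
        (\<forall>v\<in>triangle. t v $ 2 + t v $ 3 \<le> g (v$1) (v$2) \<and> g (v$1) (v$2) \<le> 2 * (t v $ 2 + t v $ 3))
      \<or> (\<exists>\<kappa>\<in>{P23, P132}. \<forall>x. perm_mat \<tau>0 *v x = perm_mat \<kappa> *v (perm_mat \<tau>1 *v x)) \<and>
        (\<forall>v. g (v$1) (v$2) = (t v $ 1 + t v $ 2) * (t v $ 2 + t v $ 3))"
proof -
  \<comment> \<open>The two bounds on the weight of \<open>(123, 132, 132)\<close>, with all products expanded.\<close>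
  have exceptional: "y + x * y \<le> x + y * y \<and> x + y * y \<le> 1 + x * y"
    if "0 < y" "y < x" "x < 1" for x y :: real
  proof -
    have "0 \<le> (1 - y) * (x - y)" "0 \<le> (1 - y) * (1 - x + y)"
      using that by simp_all
    then show ?thesis by (simp add: algebra_simps)
  qed
  show "perm_mat \<tau>1 *v (perm_mat \<sigma> *v x) = x"
    using assms(1) unfolding weighted_triples_def
    by (auto simp: perm_mat_mult_vector vec_eq_iff forall_3 simp del: perm_mat.simps)
  show "(\<forall>x. perm_mat \<tau>0 *v x = perm_mat Pe *v (perm_mat \<tau>1 *v x)) \<and>
        (\<forall>v\<in>triangle. t v $ 2 + t v $ 3 \<le> g (v$1) (v$2) \<and> g (v$1) (v$2) \<le> 2 * (t v $ 2 + t v $ 3))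
      \<or> (\<exists>\<kappa>\<in>{P23, P132}. \<forall>x. perm_mat \<tau>0 *v x = perm_mat \<kappa> *v (perm_mat \<tau>1 *v x)) \<and>
        (\<forall>v. g (v$1) (v$2) = (t v $ 1 + t v $ 2) * (t v $ 2 + t v $ 3))"
    using assms(1) unfolding weighted_triples_def t_def
    by (elim insertE emptyE)
       (simp_all add: perm_mat_mult_vector vec_eq_iff forall_3 bary_def triangle_def exceptional
         algebra_simps del: perm_mat.simps)
qed

text \<open>As \<open>\<tau>1\<close> inverts \<open>\<sigma>\<close>, the product \<open>\<tau>1 F\<^sub>1\<^sup>k F\<^sub>0\<close> collapses to \<open>A\<^sub>1\<^sup>k A\<^sub>0 \<tau>0\<close>, and each factor \<open>A\<^sub>1\<close>
  adds the third coordinate to the first.\<close>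

lemma perm_iter_mat:
  assumes conj: "\<And>x. perm_mat \<tau>1 *v (perm_mat \<sigma> *v x) = x"
    and \<tau>0: "\<And>x. perm_mat \<tau>0 *v x = perm_mat \<kappa> *v (perm_mat \<tau>1 *v x)"
  defines "w \<equiv> \<lambda>u. mat_A0 *v (perm_mat \<kappa> *v (perm_mat \<tau>1 *v u))"
  shows "perm_mat \<tau>1 *v (iter_mat \<sigma> \<tau>0 \<tau>1 k *v u) = vector [w u $ 1 + real k * w u $ 3, w u $ 2, w u $ 3]"
proof (induction k)
  case 0
  have "perm_mat \<tau>1 *v (iter_mat \<sigma> \<tau>0 \<tau>1 0 *v u) = w u"
    by (simp add: iter_mat_0 mat_F0_def conj \<tau>0 w_def flip: matrix_vector_mul_assoc)
  then show ?case by (simp add: vec_eq_iff forall_3)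
next
  case (Suc k)
  have "perm_mat \<tau>1 *v (iter_mat \<sigma> \<tau>0 \<tau>1 (Suc k) *v u)
    = mat_A1 *v (perm_mat \<tau>1 *v (iter_mat \<sigma> \<tau>0 \<tau>1 k *v u))"
    by (simp add: iter_mat_Suc mat_F1_def conj flip: matrix_vector_mul_assoc)
  then show ?case
    unfolding Suc.IH by (simp add: mat_A1_mult vec_eq_iff forall_3 algebra_simps)
qed

lemma sum_perm_mat: "(perm_mat s *v u)$1 + (perm_mat s *v u)$2 + (perm_mat s *v u)$3 = u$1 + u$2 + u$3"
  by (cases s) (simp_all add: perm_mat_mult_vector del: perm_mat.simps)

text \<open>The denominator is the sum of the coordinates, which the permutation \<open>\<tau>1\<close> preserves.\<close>

lemma branch_normal_form:
  assumes conj: "\<And>x. perm_mat \<tau>1 *v (perm_mat \<sigma> *v x) = x"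
    and \<tau>0: "\<And>x. perm_mat \<tau>0 *v x = perm_mat \<kappa> *v (perm_mat \<tau>1 *v x)"
    and v: "v \<in> triangle"
  defines "t \<equiv> \<lambda>v. perm_mat \<tau>1 *v bary v"
  defines "w \<equiv> mat_A0 *v (perm_mat \<kappa> *v t v)"
  shows "t (branch \<sigma> \<tau>0 \<tau>1 k v) =
      (1 / dpq \<sigma> \<tau>0 \<tau>1 k v $ 1) *\<^sub>R vector [w$1 + real k * w$3, w$2, w$3]"
    and "dpq \<sigma> \<tau>0 \<tau>1 k v $ 1 = w$1 + real k * w$3 + w$2 + w$3"
proof -
  note iter = perm_iter_mat[of \<tau>1 \<sigma> \<tau>0 \<kappa>, OF conj \<tau>0, of k "bary v", folded t_def, folded w_def]
  show "t (branch \<sigma> \<tau>0 \<tau>1 k v) =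
      (1 / dpq \<sigma> \<tau>0 \<tau>1 k v $ 1) *\<^sub>R vector [w$1 + real k * w$3, w$2, w$3]"
    using iter by (simp add: t_def bary_branch[OF v] matrix_vector_mult_scaleR w_def)
  show "dpq \<sigma> \<tau>0 \<tau>1 k v $ 1 = w$1 + real k * w$3 + w$2 + w$3"
    using iter sum_perm_mat[of \<tau>1 "iter_mat \<sigma> \<tau>0 \<tau>1 k *v bary v"]
    by (simp add: dpq_eq_iter mat_B_mult_1 t_def w_def)
qed

lemma perm_bary:
  fixes \<tau>1 :: S3
  defines "t \<equiv> \<lambda>v. perm_mat \<tau>1 *v bary v"
  shows "t v $ 1 + t v $ 2 + t v $ 3 = 1"
    and "v \<in> triangle \<Longrightarrow> 0 < t v $ i"
    and "continuous_on S (\<lambda>v. t v $ i)"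
proof -
  show "t v $ 1 + t v $ 2 + t v $ 3 = 1"
    unfolding t_def sum_perm_mat by (simp add: bary_def)
  show "0 < t v $ i" if "v \<in> triangle"
    using pos_perm_mat[of "bary v" \<tau>1] that by (simp add: t_def triangle_iff_pos pos_def)
  show "continuous_on S (\<lambda>v. t v $ i)"
    unfolding t_def bary_eq matrix_vector_mul_assoc by (rule continuous_on_matrix_homog)
qed

theorem corollary5:
  fixes \<sigma> \<tau>0 \<tau>1 :: S3 and g :: "real \<Rightarrow> real \<Rightarrow> real"
  assumes "(\<sigma>, \<tau>0, \<tau>1, g) \<in> weighted_triples"
  shows "transfer_well_defined \<sigma> \<tau>0 \<tau>1 g \<and>
    1 \<in> transfer_eigenvalues \<sigma> \<tau>0 \<tau>1 g \<and>
    (\<forall>l \<in> transfer_eigenvalues \<sigma> \<tau>0 \<tau>1 g. l \<le> 1)"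
proof -
  define t where "t v = perm_mat \<tau>1 *v bary v" for v
  note conj = weighted_triples_orbits(1)[OF assms]
  note sum_t = perm_bary(1)[of \<tau>1, folded t_def]
  note t_pos = perm_bary(2)[of _ \<tau>1, folded t_def]
  note t_cont = perm_bary(3)[of _ \<tau>1, folded t_def]
  note nf = branch_normal_form[of \<tau>1 \<sigma> \<tau>0, OF conj, folded t_def]
  have product_pos: "0 < (t v $ 1 + t v $ 2) * (t v $ 2 + t v $ 3)" if "v \<in> triangle" for v
    by (intro mult_pos_pos add_pos_pos t_pos that)
  have combine: "(p / d) * (q / d) * d ^ 3 = p * q * d" if "0 < d" for p q d :: real
    using that by (simp add: field_simps power3_eq_cube)
  \<comment> \<open>The factor \<open>1 / 2\<close> absorbs \<open>\<alpha> \<le> 2\<close> in the case \<open>\<kappa> = e\<close>, the factor \<open>2\<close> the weight of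
    \<open>(123, 132, 132)\<close>.\<close>
  have from_factors: ?thesis
    if spectrum: "\<And>k v. v \<in> triangle \<Longrightarrow>
        \<alpha> (branch \<sigma> \<tau>0 \<tau>1 k v) * \<beta> (branch \<sigma> \<tau>0 \<tau>1 k v) * (dpq \<sigma> \<tau>0 \<tau>1 k v $ 1) ^ 3
          = (\<alpha> v + real k * \<beta> v) * (\<alpha> v + real (Suc k) * \<beta> v)"
      and "\<And>v. v \<in> triangle \<Longrightarrow> 0 < \<alpha> v" "\<And>v. v \<in> triangle \<Longrightarrow> 0 < \<beta> v"
      and "continuous_on triangle \<alpha>" "continuous_on triangle \<beta>"
      and "\<And>v. v \<in> triangle \<Longrightarrow> 1 / 2 * (\<alpha> v * \<beta> v) \<le> g (v$1) (v$2)"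
      and "\<And>v. v \<in> triangle \<Longrightarrow> g (v$1) (v$2) \<le> 2 * (\<alpha> v * \<beta> v)" for \<alpha> \<beta>
  proof -
    have "0 < (1 / 2 :: real)" by simp
    note * = transfer_spectrum[of \<alpha> \<beta>, OF that(2-5) this that(6,7) spectrum]
    show ?thesis using *(1,2) *(3) by blast
  qed
  consider
    (e) "\<And>x. perm_mat \<tau>0 *v x = perm_mat Pe *v (perm_mat \<tau>1 *v x)"
      "\<And>v. v \<in> triangle \<Longrightarrow> t v $ 2 + t v $ 3 \<le> g (v$1) (v$2)"
      "\<And>v. v \<in> triangle \<Longrightarrow> g (v$1) (v$2) \<le> 2 * (t v $ 2 + t v $ 3)"
  | (P23) "\<And>x. perm_mat \<tau>0 *v x = perm_mat P23 *v (perm_mat \<tau>1 *v x)"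
      "\<And>v. g (v$1) (v$2) = (t v $ 1 + t v $ 2) * (t v $ 2 + t v $ 3)"
  | (P132) "\<And>x. perm_mat \<tau>0 *v x = perm_mat P132 *v (perm_mat \<tau>1 *v x)"
      "\<And>v. g (v$1) (v$2) = (t v $ 1 + t v $ 2) * (t v $ 2 + t v $ 3)"
    using weighted_triples_orbits(2)[OF assms, folded t_def] by blast
  then show ?thesis
  proof cases
    case e
    show ?thesis
    \<comment> \<open>The invariant density of the classical triangle map, \<open>1 / (x (1 + y))\<close> for \<open>\<sigma> = e\<close>. At
      \<open>S\<^sub>k v\<close> the factor \<open>\<beta>\<close> is \<open>1 / d\<close>, and \<open>d\<close> is the first of the two telescoping factors.\<close>
    proof (rule from_factors[of "\<lambda>v. 1 + t v $ 3" "\<lambda>v. t v $ 2 + t v $ 3"])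
      fix k v assume v: "v \<in> triangle"
      define d where "d = dpq \<sigma> \<tau>0 \<tau>1 k v $ 1"
      have "0 < d" using v by (simp add: d_def dpq_1_pos)
      have d: "d = 1 + t v $ 3 + real k * (t v $ 2 + t v $ 3)"
        using nf(2)[OF e(1) v] sum_t[of v]
        by (simp add: mat_A0_mult d_def perm_mat_mult_vector del: perm_mat.simps)
      have S: "t (branch \<sigma> \<tau>0 \<tau>1 k v) $ 2 = t v $ 1 / d"
        "t (branch \<sigma> \<tau>0 \<tau>1 k v) $ 3 = (t v $ 2 + t v $ 3) / d"
        using nf(1)[OF e(1) v]
        by (simp_all add: mat_A0_mult d_def perm_mat_mult_vector del: perm_mat.simps)
      have "1 + t (branch \<sigma> \<tau>0 \<tau>1 k v) $ 3 = (d + t v $ 2 + t v $ 3) / d"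
        "t (branch \<sigma> \<tau>0 \<tau>1 k v) $ 2 + t (branch \<sigma> \<tau>0 \<tau>1 k v) $ 3 = 1 / d"
        using S sum_t[of v] \<open>0 < d\<close> by (simp_all add: field_simps)
      note E = this
      show "(1 + t (branch \<sigma> \<tau>0 \<tau>1 k v) $ 3) *
          (t (branch \<sigma> \<tau>0 \<tau>1 k v) $ 2 + t (branch \<sigma> \<tau>0 \<tau>1 k v) $ 3) * (dpq \<sigma> \<tau>0 \<tau>1 k v $ 1) ^ 3
        = (1 + t v $ 3 + real k * (t v $ 2 + t v $ 3)) *
          (1 + t v $ 3 + real (Suc k) * (t v $ 2 + t v $ 3))"
        unfolding E d_def[symmetric] combine[OF \<open>0 < d\<close>] by (simp add: d algebra_simps)
    next
      fix v assume v: "v \<in> triangle"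
      have \<alpha>: "1 + t v $ 3 \<le> 2" "1 \<le> 1 + t v $ 3" and \<beta>: "0 \<le> t v $ 2 + t v $ 3"
        using sum_t[of v] t_pos[OF v, of 1] t_pos[OF v, of 2] t_pos[OF v, of 3] by linarith+
      show "1 / 2 * ((1 + t v $ 3) * (t v $ 2 + t v $ 3)) \<le> g (v$1) (v$2)"
        using mult_right_mono[OF \<alpha>(1) \<beta>] e(2)[OF v] by simp
      show "g (v$1) (v$2) \<le> 2 * ((1 + t v $ 3) * (t v $ 2 + t v $ 3))"
        using mult_right_mono[OF \<alpha>(2) \<beta>] e(3)[OF v] by simp
    qed (auto intro!: continuous_intros t_cont add_pos_pos t_pos)
  next
    case P23
    show ?thesis
    \<comment> \<open>At \<open>S\<^sub>k v\<close> the factor \<open>\<beta>\<close> is \<open>1 / d\<close>, and \<open>d\<close> is the second of the two telescoping factors.\<close>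
    proof (rule from_factors[of "\<lambda>v. t v $ 1 + t v $ 2" "\<lambda>v. t v $ 2 + t v $ 3"])
      fix k v assume v: "v \<in> triangle"
      define d where "d = dpq \<sigma> \<tau>0 \<tau>1 k v $ 1"
      have "0 < d" using v by (simp add: d_def dpq_1_pos)
      have d: "d = t v $ 1 + t v $ 2 + real (Suc k) * (t v $ 2 + t v $ 3)"
        using nf(2)[OF P23(1) v]
        by (simp add: mat_A0_mult d_def perm_mat_mult_vector algebra_simps del: perm_mat.simps)
      have S: "t (branch \<sigma> \<tau>0 \<tau>1 k v) $ 1 = (t v $ 2 + real k * (t v $ 2 + t v $ 3)) / d"
        "t (branch \<sigma> \<tau>0 \<tau>1 k v) $ 2 = t v $ 1 / d"
        "t (branch \<sigma> \<tau>0 \<tau>1 k v) $ 3 = (t v $ 2 + t v $ 3) / d"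
        using nf(1)[OF P23(1) v]
        by (simp_all add: mat_A0_mult d_def perm_mat_mult_vector add.commute del: perm_mat.simps)
      have "t (branch \<sigma> \<tau>0 \<tau>1 k v) $ 1 + t (branch \<sigma> \<tau>0 \<tau>1 k v) $ 2
          = (t v $ 1 + t v $ 2 + real k * (t v $ 2 + t v $ 3)) / d"
        "t (branch \<sigma> \<tau>0 \<tau>1 k v) $ 2 + t (branch \<sigma> \<tau>0 \<tau>1 k v) $ 3 = 1 / d"
        using sum_t[of v] unfolding S by (simp_all add: add.assoc flip: add_divide_distrib)
      note E = this
      show "(t (branch \<sigma> \<tau>0 \<tau>1 k v) $ 1 + t (branch \<sigma> \<tau>0 \<tau>1 k v) $ 2) *
          (t (branch \<sigma> \<tau>0 \<tau>1 k v) $ 2 + t (branch \<sigma> \<tau>0 \<tau>1 k v) $ 3) * (dpq \<sigma> \<tau>0 \<tau>1 k v $ 1) ^ 3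
        = (t v $ 1 + t v $ 2 + real k * (t v $ 2 + t v $ 3)) *
          (t v $ 1 + t v $ 2 + real (Suc k) * (t v $ 2 + t v $ 3))"
        unfolding E d_def[symmetric] combine[OF \<open>0 < d\<close>] by (simp add: d)
    qed (auto intro!: continuous_intros t_cont add_pos_pos t_pos less_imp_le[OF product_pos] simp: P23(2))
  next
    case P132
    show ?thesis
    \<comment> \<open>The same density as for \<open>\<kappa> = 23\<close>, but \<open>\<alpha>\<close> and \<open>\<beta>\<close> change places: here \<open>\<alpha>\<close> becomes \<open>1 / d\<close>.\<close>
    proof (rule from_factors[of "\<lambda>v. t v $ 2 + t v $ 3" "\<lambda>v. t v $ 1 + t v $ 2"])
      fix k v assume v: "v \<in> triangle"
      define d where "d = dpq \<sigma> \<tau>0 \<tau>1 k v $ 1"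
      have "0 < d" using v by (simp add: d_def dpq_1_pos)
      have d: "d = t v $ 2 + t v $ 3 + real (Suc k) * (t v $ 1 + t v $ 2)"
        using nf(2)[OF P132(1) v]
        by (simp add: mat_A0_mult d_def perm_mat_mult_vector algebra_simps del: perm_mat.simps)
      have S: "t (branch \<sigma> \<tau>0 \<tau>1 k v) $ 1 = (t v $ 2 + real k * (t v $ 1 + t v $ 2)) / d"
        "t (branch \<sigma> \<tau>0 \<tau>1 k v) $ 2 = t v $ 3 / d"
        "t (branch \<sigma> \<tau>0 \<tau>1 k v) $ 3 = (t v $ 1 + t v $ 2) / d"
        using nf(1)[OF P132(1) v]
        by (simp_all add: mat_A0_mult d_def perm_mat_mult_vector del: perm_mat.simps)
      have "t (branch \<sigma> \<tau>0 \<tau>1 k v) $ 2 + t (branch \<sigma> \<tau>0 \<tau>1 k v) $ 3 = 1 / d"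
        "t (branch \<sigma> \<tau>0 \<tau>1 k v) $ 1 + t (branch \<sigma> \<tau>0 \<tau>1 k v) $ 2
          = (t v $ 2 + t v $ 3 + real k * (t v $ 1 + t v $ 2)) / d"
        using sum_t[of v] unfolding S by (simp_all add: ac_simps flip: add_divide_distrib)
      note E = this
      show "(t (branch \<sigma> \<tau>0 \<tau>1 k v) $ 2 + t (branch \<sigma> \<tau>0 \<tau>1 k v) $ 3) *
          (t (branch \<sigma> \<tau>0 \<tau>1 k v) $ 1 + t (branch \<sigma> \<tau>0 \<tau>1 k v) $ 2) * (dpq \<sigma> \<tau>0 \<tau>1 k v $ 1) ^ 3
        = (t v $ 2 + t v $ 3 + real k * (t v $ 1 + t v $ 2)) *
          (t v $ 2 + t v $ 3 + real (Suc k) * (t v $ 1 + t v $ 2))"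
        unfolding E d_def[symmetric] combine[OF \<open>0 < d\<close>] by (simp add: d)
    qed (auto intro!: continuous_intros t_cont add_pos_pos t_pos less_imp_le[OF product_pos] simp: P132(2) mult.commute)
  qed
qed

end
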